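(* In the two-slope ski rental problem with tail constraint $(\gamma,\delta)$ described in the context, every optimal solution $f$ satisfies $\alpha_f(x)=\mathrm{OPT}$ for every $x\in[1,I_3]$, where $I_3=\frac{(\gamma-1)(1-a)}{1-a\gamma}$.
   Context: Fix $0\le a<1$ and $(\gamma,\delta)$ with $2-a\le\gamma<1/a$, $0\le\delta\le1$. A purchase distribution $f$ is a probability distribution on $[0,\infty)\cup\{\infty\}$ (buying time; $\infty$ = never buy). For buying time $t$ and stopping time $x>0$: $\alpha(t,x)=\frac{t+1-a+a(x-t)}{x}$ if $t\le x\le1$; $1$ if $t>x$, $x\le1$; $\frac{t+1-a+a(x-t)}{1-a+ax}$ if $t\le x$, $x>1$; $\frac{x}{1-a+ax}$ if $t>x$, $x>1$ (incl. $t=\infty$); $\alpha(t,\infty)=1$ for finite $t$, $\alpha(\infty,\infty)=1/a$. $\alpha_f(x)=\mathbb{E}_{t\sim f}\alpha(t,x)$. Bad interval $I_\gamma(x)=\{t:\alpha(t,x)>\gamma\}$; $f$ feasible if $f(I_\gamma(x))\le\delta$ for all $x\in(0,\infty]$. $\mathrm{OPT}=\min_{f\text{ feasible}}\sup_x\alpha_f(x)$; an optimal solution is a feasible $f$ attaining it. *)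

theory Defs
  imports "HOL-Probability.Probability"
begin

text \<open>
  Buying times range over \<^typ>\<open>ennreal\<close>, that is, over the nonnegative reals together with
  \<open>\<infinity>\<close> (never buy); stopping times are the positive elements of \<^typ>\<open>ennreal\<close>.
  The ratio is extended-valued: for \<open>a = 0\<close> the entry \<open>1 / a\<close> at \<open>(\<infinity>, \<infinity>)\<close> is \<open>\<infinity>\<close>.
  In the other branches \<^const>\<open>enn2real\<close> is applied to finite arguments only.
\<close>

definition alpha :: "real \<Rightarrow> ennreal \<Rightarrow> ennreal \<Rightarrow> ennreal" where
  "alpha a t x =
    (if x = \<infinity> then (if t < \<infinity> then 1 else 1 / ennreal a)
     else if x \<le> 1 then
       (if t \<le> x
        then ennreal ((enn2real t + 1 - a + a * (enn2real x - enn2real t)) / enn2real x)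
        else 1)
     else
       (if t \<le> x
        then ennreal ((enn2real t + 1 - a + a * (enn2real x - enn2real t))
                        / (1 - a + a * enn2real x))
        else ennreal (enn2real x / (1 - a + a * enn2real x))))"

definition purchase_distribution :: "ennreal measure \<Rightarrow> bool" where
  "purchase_distribution f \<longleftrightarrow> prob_space f \<and> sets f = sets borel"

definition alpha_dist :: "real \<Rightarrow> ennreal measure \<Rightarrow> ennreal \<Rightarrow> ennreal" where
  "alpha_dist a f x = (\<integral>\<^sup>+ t. alpha a t x \<partial>f)"

definition bad_interval :: "real \<Rightarrow> real \<Rightarrow> ennreal \<Rightarrow> ennreal set" where
  "bad_interval a \<gamma> x = {t. alpha a t x > ennreal \<gamma>}"

definition feasible :: "real \<Rightarrow> real \<Rightarrow> real \<Rightarrow> ennreal measure \<Rightarrow> bool" where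
  "feasible a \<gamma> \<delta> f \<longleftrightarrow>
    purchase_distribution f \<and> (\<forall>x>0. measure f (bad_interval a \<gamma> x) \<le> \<delta>)"

definition worst_case :: "real \<Rightarrow> ennreal measure \<Rightarrow> ennreal" where
  "worst_case a f = (SUP x\<in>{0<..}. alpha_dist a f x)"

definition OPT :: "real \<Rightarrow> real \<Rightarrow> real \<Rightarrow> ennreal" where
  "OPT a \<gamma> \<delta> = (INF f\<in>{f. feasible a \<gamma> \<delta> f}. worst_case a f)"

definition optimal :: "real \<Rightarrow> real \<Rightarrow> real \<Rightarrow> ennreal measure \<Rightarrow> bool" where
  "optimal a \<gamma> \<delta> f \<longleftrightarrow> feasible a \<gamma> \<delta> f \<and> worst_case a f = OPT a \<gamma> \<delta>"

definition I3 :: "real \<Rightarrow> real \<Rightarrow> real" where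
  "I3 a \<gamma> = (\<gamma> - 1) * (1 - a) / (1 - a * \<gamma>)"

text \<open>
  Measurability of the integrand and of the bad intervals, so that neither the integral
  nor the tail constraint takes a default value on a non-measurable argument.
\<close>

lemma measurable_alpha [measurable]: "(\<lambda>t. alpha a t x) \<in> borel_measurable borel"
  unfolding alpha_def by measurable

lemma bad_interval_in_borel [measurable]: "bad_interval a \<gamma> x \<in> sets borel"
  unfolding bad_interval_def by measurable

end

theory Submission
  imports Defs "HOL-Real_Asymp.Real_Asymp"
begin

text \<open>
  Let \<open>F\<close> be the distribution function of \<open>f\<close>, \<open>y\<close> its primitive vanishing at \<open>0\<close>,
  \<open>C = OPT\<close>, \<open>c = (C - 1) / (1 - a)\<close> and \<open>m = 1 - a c\<close>. By Fubini, \<open>\<alpha>\<^sub>f(x) \<le> C\<close> becomes the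
  integral inequality \<open>F(x) - y(x) \<le> c x\<close> for \<open>x \<le> 1\<close> and \<open>F(x) \<le> m + z(x)\<close> for \<open>x \<ge> 1\<close>, where
  \<open>z(x) = y(x) + c - m x\<close> has \<open>z' = F - m \<le> z\<close>. So \<open>z(x) \<le> z(1) exp (x - 1)\<close>, with equality
  as long as \<open>\<alpha>\<^sub>f = C\<close> on \<open>[1, x]\<close>.

  Buying times in \<open>[1, I\<^sub>3]\<close> belong to no bad interval. If \<open>\<alpha>\<^sub>f < C\<close> somewhere in \<open>[1, I\<^sub>3]\<close>,
  the equality solution started at \<open>1\<close> lies strictly above \<open>F\<close> at \<open>I\<^sub>3\<close>, say at height \<open>V\<close>.
  Following it on \<open>[1, I\<^sub>3]\<close> and continuing with \<open>max F V\<close> moves mass from later times into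
  \<open>[1, I\<^sub>3]\<close>: no bad interval gains mass, and slack is created everywhere beyond \<open>I\<^sub>3\<close>. This
  leaves room to scale \<open>F\<close> by \<open>1 - \<epsilon>\<close> on \<open>[0, 1)\<close>, which lowers \<open>c\<close> to \<open>(1 - \<epsilon>) c\<close> and
  contradicts optimality.
\<close>

section \<open>Growth of the slack under the integral inequality\<close>

lemma gronwall:
  fixes z :: "real \<Rightarrow> real"
  assumes pq: "p \<le> q" and cont: "continuous_on {p..q} z"
    and le: "\<And>x. p \<le> x \<Longrightarrow> x \<le> q \<Longrightarrow> z x \<le> k + integral {p..x} z"
  shows "z q \<le> k * exp (q - p)"
proof -
  define W where "W x = integral {p..x} z" for x
  \<comment> \<open>The weight makes \<open>g\<close> nonincreasing, as
    \<open>g' = (z - (k + W)) * exp (- x) \<le> 0\<close>. Both \<open>z\<close> and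
    \<open>k\<close> may be negative; the decay argument in \<open>slack_gain\<close> relies on
    that.\<close>
  define g where "g x = (k + W x) * exp (- x)" for x
  have contW: "continuous_on {p..q} W"
    unfolding W_def using cont
    by (intro indefinite_integral_continuous_1 integrable_continuous_interval)
  have "g q \<le> g p"
  proof (rule DERIV_nonpos_imp_decreasing_open[OF pq])
    fix x assume x: "p < x" "x < q"
    have "(W has_real_derivative z x) (at x within {p..q})"
      unfolding W_def using cont x by (intro integral_has_real_derivative) auto
    then have dW: "(W has_real_derivative z x) (at x)"
      using x by (simp add: at_within_Icc_at)
    have "(g has_real_derivative (z x * exp (- x) - (k + W x) * exp (- x))) (at x)"
      unfolding g_def by (auto intro!: derivative_eq_intros dW)
    moreover have "z x * exp (- x) - (k + W x) * exp (- x) \<le> 0"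
      using le[of x] x by (simp add: W_def)
    ultimately show "\<exists>y. (g has_real_derivative y) (at x) \<and> y \<le> 0" by blast
  next
    show "continuous_on {p..q} g"
      unfolding g_def by (intro continuous_intros contW)
  qed
  then have "k + W q \<le> k * exp (q - p)"
    by (simp add: g_def W_def exp_diff exp_minus field_simps)
  then show ?thesis using le[of q] pq by (simp add: W_def)
qed

text \<open>The limit at infinity may stay below 1, the rest being the mass of never buying, and
  \<open>F 0\<close> may be positive, an atom at 0. Only the values on nonnegative arguments are
  turned into a measure.\<close>

definition cdf_like :: "(real \<Rightarrow> real) \<Rightarrow> bool" where
  "cdf_like F \<longleftrightarrow> mono F \<and> (\<forall>x. continuous (at_right x) F) \<and> (\<forall>x. F x \<in> {0..1})"

abbreviation primitive :: "(real \<Rightarrow> real) \<Rightarrow> real \<Rightarrow> real" where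
  "primitive F x \<equiv> integral {0..x} F"

lemma cdf_like_integrable: "cdf_like F \<Longrightarrow> F integrable_on {p..q}"
  by (intro integrable_on_mono_on mono_onI) (auto simp: cdf_like_def mono_def)

lemma primitive_diff:
  assumes "cdf_like F" "0 \<le> p" "p \<le> q"
  shows "primitive F q = primitive F p + integral {p..q} F"
  using Henstock_Kurzweil_Integration.integral_combine[of 0 p q F]
    cdf_like_integrable[OF assms(1)] assms by simp

text \<open>With \<open>z x = primitive F x + k - m * x\<close>, the hypothesis says
  \<open>z' = F - m \<le> z - \<sigma>\<close>, so \<open>z - \<sigma>\<close> grows at most
  exponentially. A positive gap \<open>\<sigma>\<close> thus becomes a strict loss for
  \<open>z\<close>, and \<open>\<sigma> = 0\<close> gives the plain growth bound.\<close>

lemma slack_growth: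
  assumes F: "cdf_like F" and p: "0 \<le> p" "p \<le> q"
    and le: "\<And>x. p \<le> x \<Longrightarrow> x \<le> q \<Longrightarrow> F x + \<sigma> \<le> m + (primitive F x + k - m * x)"
  shows "primitive F q + k - m * q - \<sigma> \<le> (primitive F p + k - m * p - \<sigma>) * exp (q - p)"
proof (rule gronwall[OF p(2)])
  let ?z = "\<lambda>x. primitive F x + k - m * x - \<sigma>"
  have "continuous_on {0..q} (primitive F)"
    by (intro indefinite_integral_continuous_1 cdf_like_integrable F)
  then have "continuous_on {p..q} (primitive F)"
    by (rule continuous_on_subset) (use p in auto)
  then show cont: "continuous_on {p..q} ?z"
    by (intro continuous_intros)
  fix x assume x: "p \<le> x" "x \<le> q"
  \<comment> \<open>\<open>F\<close> may jump, so the differential inequality is used in integrated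
    form.\<close>
  have "integral {p..x} (\<lambda>s. F s - m) \<le> integral {p..x} ?z"
  proof (rule integral_le)
    show "(\<lambda>s. F s - m) integrable_on {p..x}"
      by (intro integrable_diff integrable_const_ivl cdf_like_integrable[OF F])
    show "?z integrable_on {p..x}"
      by (intro integrable_continuous_interval continuous_on_subset[OF cont]) (use x in auto)
    show "F s - m \<le> ?z s" if "s \<in> {p..x}" for s
      using le[of s] that x by auto
  qed
  moreover have "integral {p..x} (\<lambda>s. F s - m) = integral {p..x} F - m * (x - p)"
    using has_integral_diff[OF integrable_integral[OF cdf_like_integrable[OF F, of p x]]
        has_integral_const_real[of m p x]] x
    by (intro integral_unique) (simp add: mult.commute)
  ultimately show "?z x \<le> (primitive F p + k - m * p - \<sigma>) + integral {p..x} ?z"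
    using primitive_diff[OF F p(1) x(1)] by (simp add: algebra_simps)
qed

text \<open>Right-continuity spreads the strict inequality at \<open>x0\<close> over a short
  interval to its right. There \<open>slack_growth\<close> with a positive gap pushes
  \<open>z\<close> strictly below its exponential envelope, and plain growth carries the strictness
  on to \<open>I\<close>.\<close>

lemma slack_gain:
  assumes F: "cdf_like F" and I: "x0 \<in> {1..I}"
    and le: "\<And>x. 1 \<le> x \<Longrightarrow> F x \<le> m + (primitive F x + k - m * x)"
    and less: "F x0 < m + (primitive F x0 + k - m * x0)"
  shows "0 < primitive F 1 + k - m"
    and "F I < m + (primitive F 1 + k - m) * exp (I - 1)"
proof -
  define z where "z x = primitive F x + k - m * x" for x
  have growth: "z q \<le> z p * exp (q - p)" if "1 \<le> p" "p \<le> q" for p q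
    using slack_growth[OF F, of p q 0 m k] le that by (simp add: z_def)
  \<comment> \<open>Half of the slack at \<open>x0\<close>, so that the slack stays above
    \<open>\<sigma>\<close> slightly to the right.\<close>
  define \<sigma> where "\<sigma> = (m + z x0 - F x0) / 2"
  have \<sigma>: "0 < \<sigma>" "\<sigma> < m + z x0 - F x0"
    using less by (auto simp: \<sigma>_def z_def field_simps)
  have strict: "\<exists>p>x0. p < b \<and> z p < z 1 * exp (p - 1)" if b: "x0 < b" for b
  proof -
    have "continuous_on {0..x0+1} z"
      unfolding z_def
      by (intro continuous_intros indefinite_integral_continuous_1 cdf_like_integrable F)
    then have "isCont z x0"
      using I by (intro continuous_on_interior[of "{0..x0+1}"]) auto
    then have "continuous (at_right x0) (\<lambda>x. m + z x - F x)"
      using F continuous_at_imp_continuous_at_within[of x0 z "{x0<..}"]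
      by (intro continuous_intros) (auto simp: cdf_like_def)
    then have "eventually (\<lambda>x. \<sigma> < m + z x - F x) (at_right x0)"
      using \<sigma> by (auto simp: continuous_within intro: order_tendstoD)
    then obtain d where d: "x0 < d" "\<And>x. x0 < x \<Longrightarrow> x < d \<Longrightarrow> \<sigma> < m + z x - F x"
      unfolding eventually_at_right_field by blast
    define p where "p = (x0 + min b d) / 2"
    have p: "x0 < p" "p < b" "p < d"
      using b d(1) by (auto simp: p_def min_def field_simps)
    have "F x + \<sigma> \<le> m + z x" if "x0 \<le> x" "x \<le> p" for x
      using d(2)[of x] \<sigma> that p by (cases "x = x0") auto
    then have "z p - \<sigma> \<le> (z x0 - \<sigma>) * exp (p - x0)"
      using slack_growth[OF F, of x0 p \<sigma> m k] I p by (auto simp: z_def)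
    \<comment> \<open>In the bound for \<open>z p\<close>, \<open>\<sigma>\<close> is subtracted
      with the exponential factor and added back without it; this is the source of
      strictness.\<close>
    moreover have "\<sigma> < \<sigma> * exp (p - x0)"
      using \<sigma> p by simp
    ultimately have "z p < z x0 * exp (p - x0)"
      by (simp add: algebra_simps)
    also have "\<dots> \<le> z 1 * exp (x0 - 1) * exp (p - x0)"
      using growth[of 1 x0] I by (intro mult_right_mono) auto
    also have "\<dots> = z 1 * exp (p - 1)"
      by (simp flip: exp_add)
    finally show ?thesis using p by blast
  qed
  show "0 < primitive F 1 + k - m"
  proof (rule ccontr)
    assume "\<not> ?thesis"
    \<comment> \<open>Then \<open>z\<close> falls exponentially, although \<open>z x \<ge> k - m * x\<close>.\<close>
    then have z1: "z 1 \<le> 0" by (simp add: z_def)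
    obtain p where p: "x0 < p" "z p < z 1 * exp (p - 1)"
      using strict[of "x0 + 1"] by auto
    define \<kappa> where "\<kappa> = - z p"
    have \<kappa>: "\<kappa> > 0"
      using p(2) z1 mult_nonpos_nonneg[OF z1, of "exp (p - 1)"] by (auto simp: \<kappa>_def)
    have "eventually (\<lambda>u. k - m * p - m * u > - (\<kappa> * exp u)) at_top"
      using \<kappa> by real_asymp
    then obtain u where u: "u \<ge> 0" "k - m * p - m * u > - (\<kappa> * exp u)"
      using eventually_conj[OF eventually_ge_at_top[of 0]]
      by (metis (mono_tags, lifting) eventually_at_top_linorder order_refl)
    have "primitive F (p + u) \<ge> 0"
      using F by (intro Henstock_Kurzweil_Integration.integral_nonneg cdf_like_integrable)
        (auto simp: cdf_like_def)
    moreover have "z (p + u) \<le> z p * exp u"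
      using growth[of p "p + u"] p I u by auto
    ultimately show False
      using u by (simp add: z_def \<kappa>_def algebra_simps)
  qed
  have "F I < m + z 1 * exp (I - 1)"
  proof (cases "x0 = I")
    case True
    then show ?thesis using less growth[of 1 I] I by (auto simp: z_def)
  next
    case False
    then obtain p where p: "x0 < p" "p < I" "z p < z 1 * exp (p - 1)"
      using strict[of I] I by auto
    have "z I \<le> z p * exp (I - p)"
      using growth[of p I] p I by auto
    also have "\<dots> < z 1 * exp (p - 1) * exp (I - p)"
      using p by simp
    also have "\<dots> = z 1 * exp (I - 1)"
      by (simp flip: exp_add)
    finally show ?thesis using le[of I] I by (auto simp: z_def)
  qed
  then show "F I < m + (primitive F 1 + k - m) * exp (I - 1)"
    by (simp add: z_def)
qed

section \<open>Construction of the improved distribution function\<close>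

lemma continuous_at_right_cong:
  fixes f g :: "real \<Rightarrow> real"
  assumes "x < b" "\<And>t. x \<le> t \<Longrightarrow> t < b \<Longrightarrow> f t = g t" "continuous (at_right x) g"
  shows "continuous (at_right x) f"
proof -
  have "eventually (\<lambda>t. f t = g t) (at_right x)"
    using assms(1,2) by (auto simp: eventually_at_right_field intro!: exI[of _ b])
  then show ?thesis
    using assms tendsto_cong[of f g "at_right x" "g x"] by (simp add: continuous_within)
qed

text \<open>The comparisons of \<open>F'\<close> with \<open>F\<close> are what keeps the bad
  intervals within their mass bound, \<open>1 - a * c' \<le> F' I\<close> limits the mass at
  infinity, and the last two bounds encode a ratio of at most
  \<open>1 + (1 - a) * c'\<close>.\<close>

lemma improve_cdf:
  fixes a c I x0 :: real
  assumes F: "cdf_like F" and a: "0 \<le> a" and c: "0 \<le> c" and I: "x0 \<in> {1..I}"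
    and early: "\<And>x. 0 < x \<Longrightarrow> x \<le> 1 \<Longrightarrow> F x - primitive F x \<le> c * x"
    and late: "\<And>x. 1 \<le> x \<Longrightarrow> F x - primitive F x \<le> c - (1 - a * c) * (x - 1)"
    and less: "F x0 - primitive F x0 < c - (1 - a * c) * (x0 - 1)"
  obtains c' F' where "0 \<le> c'" "c' < c" "cdf_like F'"
    "\<And>x. x < 1 \<Longrightarrow> F' x \<le> F x"
    "\<And>x y. x \<le> y \<Longrightarrow> y < 1 \<or> I \<le> x \<Longrightarrow> F' y - F' x \<le> F y - F x"
    "\<And>x. I \<le> x \<Longrightarrow> F x \<le> F' x"
    "1 - a * c' \<le> F' I"
    "\<And>x. 0 < x \<Longrightarrow> x \<le> 1 \<Longrightarrow> F' x - primitive F' x \<le> c' * x"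
    "\<And>x. 1 \<le> x \<Longrightarrow> F' x - primitive F' x \<le> c' - (1 - a * c') * (x - 1)"
proof -
  define m y1 z where "m = 1 - a * c" and "y1 = primitive F 1"
    and "z x = primitive F x + c - m * x" for x
  define z0 E where "z0 = y1 + c - m" and "E = exp (I - 1)"
  \<comment> \<open>The height at \<open>I\<close> of the unperturbed equality solution;
    \<open>V\<close> below is its perturbed and capped version.\<close>
  define v where "v = m + z0 * E"
  have I1: "1 \<le> I" using I by simp
  have F01: "0 \<le> F x" "F x \<le> 1" and Fmono: "x \<le> y \<Longrightarrow> F x \<le> F y"
    and Frc: "continuous (at_right x) F" for x y
    using F by (auto simp: cdf_like_def mono_def)
  have le: "F x \<le> m + z x" if "1 \<le> x" for x
    using late[OF that] by (simp add: m_def z_def algebra_simps)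
  have "F x0 < m + z x0"
    using less by (simp add: m_def z_def algebra_simps)
  then have z0: "0 < z0" and FI: "F I < v"
    using slack_gain[OF F I, of m c] le by (auto simp: z0_def y1_def v_def E_def z_def)
  have E: "1 \<le> E" using I1 by (simp add: E_def)
  have y1: "0 \<le> y1" "y1 \<le> 1"
    using integral_le[OF cdf_like_integrable[OF F, of 0 1], of "\<lambda>_. 1"]
      Henstock_Kurzweil_Integration.integral_nonneg[OF cdf_like_integrable[OF F, of 0 1]] F01
    by (auto simp: y1_def)
  \<comment> \<open>For \<open>c = 0\<close> one has \<open>m = 1\<close>, hence
    \<open>z0 = y1 - 1 \<le> 0\<close>.\<close>
  have c0: "0 < c"
    using z0 y1 c by (cases "c = 0") (auto simp: z0_def m_def)
  \<comment> \<open>A quarter of the gap: \<open>F\<close> stays below \<open>v - 2 * \<rho>\<close>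
    up to some \<open>d > I\<close>, while \<open>V\<close> loses at most \<open>\<rho>\<close>
    unless it is capped at 1. So \<open>F' - F \<ge> \<rho>\<close> on \<open>{I..d}\<close>, a gain
    of \<open>\<rho> * (d - I)\<close>.\<close>
  define \<rho> where "\<rho> = (v - F I) / 4"
  have \<rho>: "0 < \<rho>" "F I < v - 2 * \<rho>"
    using FI by (auto simp: \<rho>_def field_simps)
  have "eventually (\<lambda>x. F x < v - 2 * \<rho>) (at_right I)"
    using Frc[of I] \<rho>(2) by (auto simp: continuous_within intro: order_tendstoD)
  then obtain d' where d': "I < d'" "\<And>x. I < x \<Longrightarrow> x < d' \<Longrightarrow> F x < v - 2 * \<rho>"
    unfolding eventually_at_right_field by blast
  define d where "d = (I + d') / 2"
  have d: "I < d" using d' by (simp add: d_def)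
  have Fd: "F x \<le> v - 2 * \<rho>" if "x \<le> d" for x
    using d'(2)[of d] d' Fmono[OF that] by (auto simp: d_def field_simps)
  \<comment> \<open>\<open>K\<close> is the rate at which the starting slack drops with
    \<open>\<epsilon>\<close> (see \<open>z1_eq\<close>). Beyond \<open>X\<close>, linear growth of
    the new slack alone makes the bound on \<open>F'\<close> at least 1.\<close>
  define K where "K = c + y1 + a * c"
  define X where "X = I + 2 * a * c / z0"
  \<comment> \<open>The conditions on \<open>\<epsilon>\<close> keep \<open>z1\<close> above
    \<open>z0 / 2\<close>, keep \<open>V\<close> above \<open>v - \<rho>\<close> or at 1, and make
    the gain on \<open>{I..d}\<close> exceed the loss at \<open>I\<close> plus the drift from the
    larger slope \<open>m'\<close> up to \<open>X\<close>.\<close>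
  have "eventually (\<lambda>\<epsilon>. 0 < \<epsilon> \<and> \<epsilon> < 1 \<and> \<epsilon> * K < z0 / 2 \<and> \<epsilon> * (K * E) < \<rho>
      \<and> \<epsilon> * (K * E + a * c * (X - I)) < \<rho> * (d - I)) (at_right 0)"
  proof -
    have small: "eventually (\<lambda>\<epsilon>. \<epsilon> * A < B) (at_right 0)" if "0 < B" for A B :: real
    proof -
      have "((\<lambda>\<epsilon>. \<epsilon> * A) \<longlongrightarrow> 0 * A) (at_right 0)" by (intro tendsto_intros)
      then show ?thesis using that by (auto intro: order_tendstoD)
    qed
    show ?thesis
      using small[of 1 1] z0 \<rho>(1) d
      by (intro eventually_conj small eventually_at_right_less) auto
  qed
  then obtain \<epsilon> where \<epsilon>: "0 < \<epsilon>" "\<epsilon> < 1" "\<epsilon> * K < z0 / 2" "\<epsilon> * (K * E) < \<rho>"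
      "\<epsilon> * (K * E + a * c * (X - I)) < \<rho> * (d - I)"
    by (auto dest!: eventually_happens)
  define c' where "c' = (1 - \<epsilon>) * c"
  define m' where "m' = 1 - a * c'"
  define z1 where "z1 = c' + (1 - \<epsilon>) * y1 - m'"
  have z1_eq: "z1 = z0 - \<epsilon> * K"
    by (simp add: z1_def z0_def K_def m'_def m_def c'_def algebra_simps)
  have z1: "z0 / 2 < z1" "0 < z1" using z1_eq \<epsilon> z0 by auto
  have c': "0 < c'" "c' < c" using c0 \<epsilon> by (auto simp: c'_def)
  have mm: "m' - m = \<epsilon> * (a * c)" "m \<le> m'"
    using \<epsilon> a c0 by (auto simp: m'_def m_def c'_def algebra_simps)
  \<comment> \<open>The cap \<open>a * c' = 1 - m'\<close> keeps \<open>m' + h\<close> below \<open>1\<close>.\<close>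
  define h where "h s = min (a * c') (z1 * exp (s - 1))" for s
  have hmono: "h s \<le> h t" if "s \<le> t" for s t
    unfolding h_def using that z1 by (intro min.mono) auto
  have h0: "0 \<le> h s" "m' + h s \<le> 1" for s
    using a c' z1 by (auto simp: h_def m'_def)
  define V where "V = m' + h I"
  have V_ge: "min 1 (v - \<rho>) \<le> V"
  proof -
    have "v - \<rho> \<le> m' + z1 * E"
      using mm \<epsilon> by (simp add: v_def z1_eq algebra_simps)
    then show ?thesis by (auto simp: V_def h_def m'_def E_def min_def)
  qed
  have FV: "F I \<le> V" using V_ge F01(2)[of I] \<rho> by linarith
  define F' where "F' x = (if x < 1 then (1 - \<epsilon>) * F x
      else if x \<le> I then m' + h x else max (F x) V)" for x
  have F'1: "(1 - \<epsilon>) * F x \<le> m' + h 1" if "x < 1" for x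
  proof -
    \<comment> \<open>Here \<open>m' + h 1\<close> is the minimum of 1 and
      \<open>(1 - \<epsilon>) * (c + y1)\<close>, so both bounds on
      \<open>(1 - \<epsilon>) * F x\<close> are used.\<close>
    have "F x \<le> c + y1"
      using late[of 1] Fmono[of x 1] that by (simp add: y1_def)
    then have "(1 - \<epsilon>) * F x \<le> (1 - \<epsilon>) * (c + y1)"
      using \<epsilon> by (intro mult_left_mono) auto
    moreover have "(1 - \<epsilon>) * F x \<le> 1 * 1"
      using \<epsilon> F01 by (intro mult_mono) auto
    ultimately show ?thesis
      by (auto simp: h_def m'_def z1_def c'_def algebra_simps min_def)
  qed
  have F'_I: "F' x = max (F x) V" if "I \<le> x" for x
    using that FV I1 by (cases "x = I") (auto simp: F'_def V_def)
  have F': "cdf_like F'"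
    unfolding cdf_like_def
  proof (intro conjI allI monoI)
    fix x y :: real assume xy: "x \<le> y"
    have *: "(1 - \<epsilon>) * F x \<le> (1 - \<epsilon>) * F y"
      using Fmono[OF xy] \<epsilon> by (intro mult_left_mono) auto
    have **: "m' + h s \<le> V" if "s \<le> I" for s using hmono[OF that] by (simp add: V_def)
    consider "y < 1" | "x < 1" "1 \<le> y" "y \<le> I" | "x < 1" "I < y" | "1 \<le> x" "y \<le> I"
      | "1 \<le> x" "x \<le> I" "I < y" | "I < x"
      using xy by linarith
    then show "F' x \<le> F' y"
    proof cases
      case 2 then show ?thesis using F'1[of x] hmono[of 1 y] by (auto simp: F'_def)
    next
      case 3 then show ?thesis
        using F'1[of x] hmono[of 1 I] I1 by (auto simp: F'_def V_def max_def)
    next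
      case 6 then show ?thesis using Fmono[OF xy] xy I1 by (auto simp: F'_def max_def)
    qed (use xy * hmono[OF xy] **[of x] I1 in \<open>auto simp: F'_def\<close>)
  next
    fix x :: real
    consider "x < 1" | "1 \<le> x" "x < I" | "I \<le> x" by linarith
    then show "continuous (at_right x) F'"
    proof cases
      case 1
      then show ?thesis
        by (intro continuous_at_right_cong[of x 1 F' "\<lambda>x. (1 - \<epsilon>) * F x"] continuous_intros Frc)
          (auto simp: F'_def)
    next
      case 2
      have "continuous (at_right x) (\<lambda>x. m' + h x)"
        unfolding h_def by (intro continuous_intros)
      then show ?thesis
        using 2 by (intro continuous_at_right_cong[of x I F' "\<lambda>x. m' + h x"]) (auto simp: F'_def)
    next
      case 3
      have "continuous (at_right x) (\<lambda>x. max (F x) V)" by (intro continuous_intros Frc)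
      then show ?thesis
        using 3 by (intro continuous_at_right_cong[of x "x + 1" F' "\<lambda>x. max (F x) V"])
          (auto simp: F'_I)
    qed
  next
    fix x :: real
    \<comment> \<open>The sign of \<open>m'\<close> is unknown; nonnegativity is inherited from
      \<open>F 0\<close> through \<open>F'1\<close>.\<close>
    have "0 \<le> m' + h t" if "1 \<le> t" for t
      using order_trans[OF _ F'1[of 0]] hmono[OF that] F01[of 0] \<epsilon>
      by (smt (verit) mult_nonneg_nonneg)
    moreover have "(1 - \<epsilon>) * F x \<le> 1 * 1" "0 \<le> (1 - \<epsilon>) * F x"
      using \<epsilon> F01[of x] by (intro mult_mono mult_nonneg_nonneg; simp)+
    ultimately show "F' x \<in> {0..1}"
      using F01[of x] h0[of x] h0[of I] I1 by (auto simp: F'_def V_def)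
  qed
  have prim1: "primitive F' x = (1 - \<epsilon>) * primitive F x" if "x \<le> 1" for x
  proof -
    \<comment> \<open>At the single point 1, \<open>F'\<close> already follows the second
      branch.\<close>
    have "primitive F' x = integral {0..x} (\<lambda>s. (1 - \<epsilon>) * F s)"
      using that by (intro integral_spike[of "{1}"]) (auto simp: F'_def)
    then show ?thesis by simp
  qed
  have F'1_le: "F' 1 \<le> c' + (1 - \<epsilon>) * y1"
    using I1 by (auto simp: F'_def h_def z1_def)
  define z' where "z' x = primitive F' x + c' - m' * x" for x
  have z'1: "z' 1 = z1" by (simp add: z'_def z1_def prim1 y1_def)
  have z'_diff: "z' x = z' p + integral {p..x} F' - m' * (x - p)" if "1 \<le> p" "p \<le> x" for p x
    using primitive_diff[OF F', of p x] that by (simp add: z'_def algebra_simps)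
  \<comment> \<open>Despite the cap no case distinction is needed, because \<open>h s \<ge> h x * exp (s - x)\<close> for \<open>s \<le> x\<close>.\<close>
  have z'_h: "h x \<le> z' x" if x: "1 \<le> x" "x \<le> I" for x
  proof -
    have i: "((\<lambda>s. m' + h x * exp (s - x)) has_integral
        (m' * x + h x * exp (x - x)) - (m' * 1 + h x * exp (1 - x))) {1..x}"
      using x by (intro fundamental_theorem_of_calculus)
        (auto intro!: derivative_eq_intros simp flip: has_real_derivative_iff_has_vector_derivative)
    have "integral {1..x} (\<lambda>s. m' + h x * exp (s - x)) \<le> integral {1..x} F'"
    proof (rule integral_le)
      show "(\<lambda>s. m' + h x * exp (s - x)) integrable_on {1..x}" using i by blast
      show "F' integrable_on {1..x}" by (rule cdf_like_integrable[OF F'])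
      fix s assume s: "s \<in> {1..x}"
      have "h x * exp (s - x) \<le> a * c' * 1"
        using s h0 a c' by (intro mult_mono) (auto simp: h_def)
      moreover have "h x * exp (s - x) \<le> z1 * exp (x - 1) * exp (s - x)"
        by (intro mult_right_mono) (auto simp: h_def)
      then have "h x * exp (s - x) \<le> z1 * exp (s - 1)"
        by (simp add: mult.assoc flip: exp_add)
      ultimately have "h x * exp (s - x) \<le> h s" by (simp add: h_def)
      then show "m' + h x * exp (s - x) \<le> F' s" using s x by (auto simp: F'_def)
    qed
    moreover have "h x * exp (1 - x) \<le> z1 * exp (x - 1) * exp (1 - x)"
      by (intro mult_right_mono) (auto simp: h_def)
    then have "h x * exp (1 - x) \<le> z1"
      by (simp add: mult.assoc flip: exp_add)
    ultimately show ?thesis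
      using z'_diff[of 1 x] x z'1 integral_unique[OF i] by (simp add: algebra_simps)
  qed
  \<comment> \<open>From \<open>I\<close> on, \<open>F' - m' \<ge> h I\<close>, so the slack rises
    with at least that slope.\<close>
  have z'_tail: "h I * (1 + (x - I)) \<le> z' x" if x: "I \<le> x" for x
  proof -
    have "integral {I..x} (\<lambda>_. V) \<le> integral {I..x} F'"
      by (intro integral_le cdf_like_integrable[OF F']) (auto simp: F'_I)
    then show ?thesis
      using z'_diff[OF I1 x] z'_h[OF I1] x by (simp add: V_def algebra_simps)
  qed
  have late': "F' x \<le> m' + z' x" if x: "1 \<le> x" for x
  proof -
    consider "x \<le> I" | "I \<le> x" "F x \<le> V" | "I < x" "V < F x" by linarith
    then show ?thesis
    proof cases
      case 1
      then show ?thesis using z'_h[OF x 1] x by (simp add: F'_def)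
    next
      case 2
      then have "h I * 1 \<le> h I * (1 + (x - I))" using h0 by (intro mult_left_mono) auto
      then show ?thesis using z'_tail[of x] 2 by (simp add: F'_I V_def)
    next
      case 3
      \<comment> \<open>\<open>V < 1\<close> means that the cap is inactive at \<open>I\<close>. As
        \<open>F\<close> stays below \<open>V\<close> up to \<open>d\<close>, the point
        \<open>x\<close> lies past the whole gain interval.\<close>
      have "V < 1" using 3 F01(2)[of x] by simp
      then have hI: "h I = z1 * E" by (auto simp: V_def h_def m'_def E_def min_def split: if_splits)
      have V_ge': "v - \<rho> \<le> V" using V_ge \<open>V < 1\<close> by simp
      have xd: "d < x"
      proof (rule ccontr)
        assume "\<not> d < x"
        then show False using Fd[of x] V_ge' 3 \<rho> by simp
      qed
      show ?thesis
      proof (cases "X \<le> x")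
        case True
        have "a * c' \<le> 2 * a * c / z0 * (z0 / 2)"
          using c' a z0 by (simp add: mult_left_mono)
        also have "\<dots> \<le> (x - I) * z1"
          using True z1 a c0 z0 3 by (intro mult_mono) (auto simp: X_def)
        also have "\<dots> \<le> (1 + (x - I)) * (z1 * E)"
          using 3 z1 E by (intro mult_mono) auto
        also have "\<dots> \<le> z' x" using z'_tail[of x] 3 by (simp add: hI mult.commute)
        finally show ?thesis using 3 F01(2)[of x] by (simp add: F'_I m'_def)
      next
        case False
        \<comment> \<open>Before \<open>X\<close>, \<open>z'\<close> is compared with
          \<open>z\<close>: it may start lower at \<open>I\<close> by at most
          \<open>\<epsilon> * (K * E)\<close>, gains \<open>\<rho> * (d - I)\<close>, and after
          \<open>d\<close> only the slope drift counts against it, since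
          \<open>F' \<ge> F\<close>.\<close>
        have zI: "z I \<le> z0 * E"
          using slack_growth[OF F, of 1 I 0 m c] le I1
          by (simp add: z_def z0_def y1_def E_def)
        have "integral {I..d} (\<lambda>_. \<rho>) \<le> integral {I..d} (\<lambda>s. F' s - F s)"
        proof (intro integral_le integrable_const_ivl integrable_diff cdf_like_integrable F F')
          show "\<rho> \<le> F' s - F s" if "s \<in> {I..d}" for s
            using Fd[of s] V_ge' that by (auto simp: F'_I)
        qed
        moreover have "0 \<le> integral {d..x} (\<lambda>s. F' s - F s)"
          using d by (intro Henstock_Kurzweil_Integration.integral_nonneg integrable_diff
              cdf_like_integrable F F') (auto simp: F'_I)
        ultimately have "\<rho> * (d - I) \<le> integral {I..x} (\<lambda>s. F' s - F s)"
          using Henstock_Kurzweil_Integration.integral_combine[of I d x "\<lambda>s. F' s - F s",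
              OF _ _ integrable_diff[OF cdf_like_integrable[OF F'] cdf_like_integrable[OF F]]] d xd
          by (simp add: mult.commute)
        moreover have "integral {I..x} (\<lambda>s. F' s - F s) = integral {I..x} F' - integral {I..x} F"
          by (intro Henstock_Kurzweil_Integration.integral_diff cdf_like_integrable F F')
        moreover have "z x = z I + integral {I..x} F - m * (x - I)"
          using primitive_diff[OF F, of I x] I1 3 by (simp add: z_def algebra_simps)
        moreover have "z' x = z' I + integral {I..x} F' - m' * (x - I)"
          using 3 by (intro z'_diff I1) simp
        moreover have "z1 * E \<le> z' I" using z'_h[OF I1] hI by simp
        moreover have "(m' - m) * (x - I) \<le> \<epsilon> * (a * c) * (X - I)"
          unfolding mm(1) using False \<epsilon> a c0 by (intro mult_left_mono) auto
        ultimately have "z x \<le> z' x"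
          using zI \<epsilon>(5) by (simp add: z1_eq algebra_simps)
        then show ?thesis using le[OF x] mm 3 by (simp add: F'_I)
      qed
    qed
  qed
  show thesis
  proof (rule that[of c' F'])
    show "F' x \<le> F x" if "x < 1" for x
      using that F01(1)[of x] \<epsilon> by (simp add: F'_def mult_left_le_one_le)
    show "F' y - F' x \<le> F y - F x" if xy: "x \<le> y" "y < 1 \<or> I \<le> x" for x y
    proof (cases "y < 1")
      case True
      have "\<epsilon> * F x \<le> \<epsilon> * F y" using Fmono[OF xy(1)] \<epsilon> by simp
      then show ?thesis using True xy by (simp add: F'_def algebra_simps)
    next
      case False
      then show ?thesis using xy Fmono[OF xy(1)] by (auto simp: F'_I)
    qed
    show "F x \<le> F' x" if "I \<le> x" for x using that by (simp add: F'_I)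
    show "1 - a * c' \<le> F' I" using h0(1)[of I] by (simp add: F'_I V_def m'_def)
    show "F' x - primitive F' x \<le> c' * x" if x: "0 < x" "x \<le> 1" for x
    proof (cases "x = 1")
      case True
      then show ?thesis using F'1_le by (simp add: prim1 y1_def)
    next
      case False
      have "(1 - \<epsilon>) * (F x - primitive F x) \<le> (1 - \<epsilon>) * (c * x)"
        using early[OF x] \<epsilon> by (intro mult_left_mono) auto
      then show ?thesis using False x by (simp add: F'_def prim1 c'_def algebra_simps)
    qed
    show "F' x - primitive F' x \<le> c' - (1 - a * c') * (x - 1)" if "1 \<le> x" for x
      using late'[OF that] by (simp add: z'_def m'_def algebra_simps)
  qed (use c' F' in auto)
qed

section \<open>Distribution functions of purchase distributions\<close>

definition dist_cdf :: "ennreal measure \<Rightarrow> real \<Rightarrow> real" where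
  "dist_cdf f x = measure f {..ennreal x}"

lemma cdf_like_dist_cdf:
  assumes "purchase_distribution f"
  shows "cdf_like (dist_cdf f)"
  unfolding cdf_like_def
proof (intro conjI allI monoI)
  interpret prob_space f using assms by (simp add: purchase_distribution_def)
  have sets [measurable_cong, simp]: "sets f = sets borel"
    using assms by (simp add: purchase_distribution_def)
  show "dist_cdf f x \<le> dist_cdf f y" if "x \<le> y" for x y
    using that unfolding dist_cdf_def
    by (intro finite_measure_mono) (auto intro: order_trans ennreal_leI)
  show "dist_cdf f x \<in> {0..1}" for x
    by (simp add: dist_cdf_def)
  show "continuous (at_right x) (dist_cdf f)" for x
    unfolding continuous_within
  proof (rule tendsto_at_right_sequentially[where b="x + 1"])
    fix s :: "nat \<Rightarrow> real" assume s: "decseq s" "s \<longlonglongrightarrow> x"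
    then have "(\<lambda>n. dist_cdf f (s n)) \<longlonglongrightarrow> measure f (\<Inter>i. {..ennreal (s i)})"
      unfolding dist_cdf_def
      by (intro finite_Lim_measure_decseq)
        (auto simp: decseq_def intro: order_trans ennreal_leI)
    also have "(\<Inter>i. {..ennreal (s i)}) = {..ennreal x}"
      using decseq_ge[OF s] LIMSEQ_le_const[OF tendsto_ennrealI[OF s(2)]]
      by (fastforce intro: order_trans[OF _ ennreal_leI])
    finally show "(\<lambda>n. dist_cdf f (s n)) \<longlonglongrightarrow> dist_cdf f x"
      by (simp add: dist_cdf_def)
  qed simp
qed

text \<open>Quantile transform: push the uniform measure on the unit interval forward along the
  generalized inverse of \<open>F\<close>.\<close>

lemma exists_distribution_with_cdf:
  assumes F: "cdf_like F"
  obtains f where "purchase_distribution f" "\<And>x. 0 \<le> x \<Longrightarrow> dist_cdf f x = F x"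
proof -
  have F01: "0 \<le> F x" "F x \<le> 1" and Fmono: "x \<le> y \<Longrightarrow> F x \<le> F y"
    and Frc: "continuous (at_right x) F" for x y
    using F by (auto simp: cdf_like_def mono_def)
  \<comment> \<open>The quantile function; since \<open>Inf {} = \<infinity>\<close>, the missing mass goes to \<open>\<infinity>\<close>.\<close>
  define Q where "Q u = Inf {ennreal x |x. 0 \<le> x \<and> u \<le> F x}" for u
  have Q_le: "Q u \<le> ennreal x \<longleftrightarrow> u \<le> F x" if x: "0 \<le> x" for u x
  proof
    assume "u \<le> F x"
    then show "Q u \<le> ennreal x" unfolding Q_def using x by (intro Inf_lower) auto
  next
    assume Q: "Q u \<le> ennreal x"
    \<comment> \<open>Attainment of the infimum is not clear a priori, so the inequality is shown
      for all \<open>y > x\<close> first and then passed to \<open>x\<close> by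
      right-continuity.\<close>
    have "u \<le> F y" if "x < y" for y
    proof -
      have "Q u < ennreal y" using Q x that by (simp add: ennreal_lessI order_le_less_trans)
      then obtain r where "0 \<le> r" "u \<le> F r" "ennreal r < ennreal y"
        unfolding Q_def Inf_less_iff by auto
      then show ?thesis using Fmono[of r y] by (auto simp: ennreal_less_iff)
    qed
    then have "eventually (\<lambda>y. u \<le> F y) (at_right x)"
      by (auto simp: eventually_at_right_field intro!: exI[of _ "x + 1"])
    then show "u \<le> F x"
      using Frc[of x] by (intro tendsto_lowerbound[of F "F x" "at_right x"])
        (auto simp: continuous_within)
  qed
  let ?U = "uniform_measure lborel {0..1::real}"
  interpret U: prob_space ?U by (intro prob_space_uniform_measure) auto
  have Q_meas: "Q \<in> borel_measurable ?U"
  proof (rule borel_measurableI_le)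
    fix y :: ennreal
    show "{u \<in> space ?U. Q u \<le> y} \<in> sets ?U"
    proof (cases y)
      case (real r)
      then have "{u \<in> space ?U. Q u \<le> y} = {..F r}" by (auto simp: Q_le)
      then show ?thesis by simp
    qed simp
  qed
  define f where "f = distr ?U borel Q"
  have "purchase_distribution f"
    unfolding purchase_distribution_def f_def using Q_meas
    by (auto intro: U.prob_space_distr)
  moreover have "dist_cdf f x = F x" if "0 \<le> x" for x
  proof -
    have "dist_cdf f x = measure ?U {..F x}"
      unfolding dist_cdf_def f_def using Q_meas that
      by (subst measure_distr) (auto simp: vimage_def Q_le atMost_def)
    also have "\<dots> = measure lborel ({0..1} \<inter> {..F x})"
      by (subst measure_uniform_measure) auto
    also have "{0..1} \<inter> {..F x} = {0..F x}" using F01[of x] by auto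
    finally show ?thesis using F01[of x] by simp
  qed
  ultimately show thesis using that by blast
qed

section \<open>The ratio in terms of the distribution function\<close>

lemma integral_overshoot:
  assumes f: "purchase_distribution f" and x: "0 \<le> x"
  shows "(\<integral>t. indicator {..ennreal x} t * (x - enn2real t) \<partial>f) = primitive (dist_cdf f) x"
proof -
  interpret prob_space f using f by (simp add: purchase_distribution_def)
  have sets [measurable_cong, simp]: "sets f = sets borel"
    using f by (simp add: purchase_distribution_def)
  interpret pair_sigma_finite f lborel ..
  have [measurable]: "dist_cdf f \<in> borel_measurable borel"
    using cdf_like_dist_cdf[OF f] by (intro borel_measurable_mono) (simp add: cdf_like_def)
  have F01: "0 \<le> dist_cdf f s" "dist_cdf f s \<le> 1" for s
    by (auto simp: dist_cdf_def)
  \<comment> \<open>The overshoot \<open>x - t\<close> is the length of the interval from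
    \<open>t\<close> to \<open>x\<close>. Written as an integral over \<open>s\<close>, it allows
    exchanging the order of integration, and the inner integral becomes
    \<open>dist_cdf f s\<close>.\<close>
  let ?g = "\<lambda>t s. indicator {(t, s). 0 \<le> s \<and> s \<le> x \<and> t \<le> ennreal s} (t, s) :: ennreal"
  have inner: "(\<integral>\<^sup>+ s. ?g t s \<partial>lborel) = ennreal (indicator {..ennreal x} t * (x - enn2real t))" for t
  proof (cases "t \<le> ennreal x")
    case True
    then obtain r where r: "t = ennreal r" "0 \<le> r" "r \<le> x"
      using x by (cases t) (auto simp: top_unique)
    have "?g t s = indicator {r..x} s" for s
      using r by (auto simp: indicator_def ennreal_le_iff2)
    then show ?thesis using r True by simp
  next
    case False
    have "?g t s = 0" for s
      using False order_trans[of t "ennreal s" "ennreal x"] by (auto simp: indicator_def ennreal_leI)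
    then show ?thesis using False by simp
  qed
  have "(\<integral>\<^sup>+ t. ennreal (indicator {..ennreal x} t * (x - enn2real t)) \<partial>f)
      = (\<integral>\<^sup>+ t. \<integral>\<^sup>+ s. ?g t s \<partial>lborel \<partial>f)"
    by (simp only: inner)
  also have "\<dots> = (\<integral>\<^sup>+ s. \<integral>\<^sup>+ t. ?g t s \<partial>f \<partial>lborel)"
    by (subst Fubini') (auto simp: split_beta')
  also have "\<dots> = (\<integral>\<^sup>+ s. ennreal (indicator {0..x} s * dist_cdf f s) \<partial>lborel)"
  proof (intro nn_integral_cong)
    fix s :: real
    have "(\<integral>\<^sup>+ t. ?g t s \<partial>f) = (\<integral>\<^sup>+ t. indicator {0..x} s * indicator {..ennreal s} t \<partial>f)"
      by (intro nn_integral_cong) (auto simp: indicator_def)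
    also have "\<dots> = ennreal (indicator {0..x} s * dist_cdf f s)"
      by (subst nn_integral_cmult)
        (auto simp: dist_cdf_def emeasure_eq_measure split: split_indicator)
    finally show "(\<integral>\<^sup>+ t. ?g t s \<partial>f) = ennreal (indicator {0..x} s * dist_cdf f s)" .
  qed
  finally have eq: "(\<integral>\<^sup>+ t. ennreal (indicator {..ennreal x} t * (x - enn2real t)) \<partial>f)
      = (\<integral>\<^sup>+ s. ennreal (indicator {0..x} s * dist_cdf f s) \<partial>lborel)" .
  have nonneg: "0 \<le> indicator {..ennreal x} t * (x - enn2real t)" for t
    using enn2real_mono[of t "ennreal x"] x by (auto simp: indicator_def)
  have "(\<integral>t. indicator {..ennreal x} t * (x - enn2real t) \<partial>f)
      = (\<integral>s. indicator {0..x} s * dist_cdf f s \<partial>lborel)"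
    using F01 nonneg by (subst (1 2) integral_eq_nn_integral) (auto simp: eq)
  also have "\<dots> = primitive (dist_cdf f) x"
  proof -
    have "set_integrable lborel {0..x} (dist_cdf f)"
      unfolding set_integrable_def using F01 x
      by (intro integrableI_bounded_set_indicator[where B=1]) auto
    then show ?thesis
      using set_borel_integral_eq_integral(2)[of "{0..x}" "dist_cdf f"]
      by (simp add: set_lebesgue_integral_def)
  qed
  finally show ?thesis .
qed

text \<open>With \<open>i\<close> the indicator of \<open>t \<le> x\<close> and \<open>j\<close> the
  positive part of \<open>x - t\<close>, the four finite branches of \<open>alpha\<close> collapse
  to \<open>(x + (1 - a) * (i - j)) / D\<close>, which is linear in \<open>i\<close> and
  \<open>j\<close>.\<close>

lemma alpha_dist_real:
  assumes f: "purchase_distribution f" and a: "0 \<le> a" "a < 1" and x: "0 < x"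
  shows "alpha_dist a f (ennreal x) =
    ennreal ((x + (1 - a) * (dist_cdf f x - primitive (dist_cdf f) x))
      / (if x \<le> 1 then x else 1 - a + a * x))"
proof -
  interpret prob_space f using f by (simp add: purchase_distribution_def)
  have sets [measurable_cong, simp]: "sets f = sets borel"
    using f by (simp add: purchase_distribution_def)
  define D where "D = (if x \<le> 1 then x else 1 - a + a * x)"
  have D: "0 < D" using x a by (auto simp: D_def intro: add_pos_nonneg)
  define j where "j t = (indicator {..ennreal x} t * (x - enn2real t) :: real)" for t
  define i where "i t = (indicator {..ennreal x} t :: real)" for t
  have [measurable]: "i \<in> borel_measurable f" "j \<in> borel_measurable f"
    unfolding i_def j_def by measurable
  have j: "0 \<le> j t" "j t \<le> x * i t" for t
    using enn2real_mono[of t "ennreal x"] x by (auto simp: j_def i_def indicator_def)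
  have i: "0 \<le> i t" "i t \<le> 1" for t by (auto simp: i_def)
  have jx: "j t \<le> x" for t
    using order_trans[OF j(2) mult_left_le[OF i(2)]] x by simp
  have int: "integrable f i" "integrable f j"
    using i j jx
    by (auto intro!: integrable_const_bound[of i 1] integrable_const_bound[of j x])
  have eq: "alpha a t (ennreal x) = ennreal ((x + (1 - a) * (i t - j t)) / D)" for t
  proof (cases "t \<le> ennreal x")
    case True
    then obtain r where r: "t = ennreal r" "0 \<le> r" "r \<le> x"
      using x by (cases t) (auto simp: top_unique)
    then show ?thesis
      using x by (auto simp: alpha_def D_def i_def j_def algebra_simps)
  next
    case False
    then show ?thesis
      using x by (auto simp: alpha_def D_def i_def j_def)
  qed
  \<comment> \<open>\<open>ennreal\<close> truncates negative reals, so this is needed to pass to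
    the real integral.\<close>
  have pos: "0 \<le> (x + (1 - a) * (i t - j t)) / D" for t
  proof -
    have "(1 - a) * (j t - i t) \<le> 1 * x"
    proof (cases "j t \<le> i t")
      case True
      then have "(1 - a) * (j t - i t) \<le> 0" using a by (intro mult_nonneg_nonpos) auto
      then show ?thesis using x by simp
    next
      case False
      then show ?thesis
        using a i[of t] jx[of t] by (intro mult_mono) auto
    qed
    then show ?thesis using D by (simp add: algebra_simps)
  qed
  have "alpha_dist a f (ennreal x) = (\<integral>\<^sup>+ t. ennreal ((x + (1 - a) * (i t - j t)) / D) \<partial>f)"
    by (simp add: alpha_dist_def eq)
  also have "\<dots> = ennreal (\<integral>t. (x + (1 - a) * (i t - j t)) / D \<partial>f)"
    using pos int by (intro nn_integral_eq_integral) auto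
  also have "(\<integral>t. (x + (1 - a) * (i t - j t)) / D \<partial>f)
      = (x + (1 - a) * ((\<integral>t. i t \<partial>f) - (\<integral>t. j t \<partial>f))) / D"
    using int by (simp add: prob_space)
  also have "(\<integral>t. i t \<partial>f) = dist_cdf f x"
    by (simp add: i_def[abs_def] dist_cdf_def)
  also have "(\<integral>t. j t \<partial>f) = primitive (dist_cdf f) x"
    unfolding j_def using f x by (intro integral_overshoot) auto
  finally show ?thesis by (simp add: D_def)
qed

text \<open>The substitution \<open>C = 1 + (1 - a) * c\<close> makes \<open>C * D\<close> minus the
  numerator equal to \<open>(1 - a) * (B - G)\<close> in both regimes.\<close>

lemma ratio_bound_iff:
  fixes a c x G :: real
  assumes "0 \<le> a" "a < 1" "0 < x"
  defines "B \<equiv> (if x \<le> 1 then c * x else c - (1 - a * c) * (x - 1))"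
    and "D \<equiv> (if x \<le> 1 then x else 1 - a + a * x)"
  shows "(x + (1 - a) * G) / D \<le> 1 + (1 - a) * c \<longleftrightarrow> G \<le> B"
    and "(x + (1 - a) * G) / D < 1 + (1 - a) * c \<longleftrightarrow> G < B"
proof -
  have D: "0 < D" using assms by (auto simp: D_def intro: add_pos_nonneg)
  have "(1 + (1 - a) * c) * D - (x + (1 - a) * G) = (1 - a) * (B - G)"
    by (simp add: D_def B_def algebra_simps)
  moreover have "0 \<le> (1 - a) * (B - G) \<longleftrightarrow> G \<le> B" "0 < (1 - a) * (B - G) \<longleftrightarrow> G < B"
    using assms by (auto simp: zero_le_mult_iff zero_less_mult_iff)
  ultimately show "(x + (1 - a) * G) / D \<le> 1 + (1 - a) * c \<longleftrightarrow> G \<le> B"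
    "(x + (1 - a) * G) / D < 1 + (1 - a) * c \<longleftrightarrow> G < B"
    using D by (auto simp: pos_divide_le_eq pos_divide_less_eq)
qed

section \<open>Bad intervals and transfer of feasibility\<close>

lemma measure_above_below:
  assumes f: "purchase_distribution f" and x: "0 \<le> x"
  shows "measure f {t. t \<le> ennreal x \<and> l < enn2real t} =
    (if x \<le> l then 0 else if l < 0 then dist_cdf f x else dist_cdf f x - dist_cdf f l)"
proof -
  interpret prob_space f using f by (simp add: purchase_distribution_def)
  have sets: "sets f = sets borel" using f by (simp add: purchase_distribution_def)
  consider "x \<le> l" | "l < x" "l < 0" | "l < x" "0 \<le> l" by linarith
  then show ?thesis
  proof cases
    case 1
    have e: "{t. t \<le> ennreal x \<and> l < enn2real t} = {}"
      using enn2real_mono[of _ "ennreal x"] 1 x by force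
    show ?thesis unfolding e using 1 by simp
  next
    case 2
    \<comment> \<open>For negative \<open>l\<close> an atom at 0 must count, whereas
      \<open>dist_cdf f l\<close> would remove it because \<open>ennreal l = 0\<close>.\<close>
    have "{t. t \<le> ennreal x \<and> l < enn2real t} = {..ennreal x}"
      using 2 by (auto intro: less_le_trans)
    then show ?thesis using 2 by (simp add: dist_cdf_def)
  next
    case 3
    have "l < enn2real t \<longleftrightarrow> \<not> t \<le> ennreal l" if "t \<le> ennreal x" for t
      using that 3 by (cases t) (auto simp: top_unique)
    then have "{t. t \<le> ennreal x \<and> l < enn2real t} = {..ennreal x} - {..ennreal l}"
      by auto
    then show ?thesis
      using 3 by (simp add: dist_cdf_def sets finite_measure_Diff ennreal_leI)
  qed
qed

text \<open>Buying after \<open>x\<close> has ratio 1, hence is never bad; for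
  \<open>t \<le> x\<close> the condition is linear in \<open>t\<close>.\<close>

lemma bad_interval_le_one:
  assumes "0 \<le> a" "a < 1" "2 - a \<le> \<gamma>" "0 < x" "x \<le> 1"
  shows "bad_interval a \<gamma> (ennreal x)
    = {t. t \<le> ennreal x \<and> (\<gamma> - a) / (1 - a) * x - 1 < enn2real t}"
proof (intro set_eqI)
  fix t :: ennreal
  show "t \<in> bad_interval a \<gamma> (ennreal x) \<longleftrightarrow>
      t \<in> {t. t \<le> ennreal x \<and> (\<gamma> - a) / (1 - a) * x - 1 < enn2real t}"
  proof (cases "t \<le> ennreal x")
    case True
    then obtain r where r: "t = ennreal r" "0 \<le> r" "r \<le> x"
      using assms by (cases t) (auto simp: top_unique)
    have "\<gamma> < (r + 1 - a + a * (x - r)) / x \<longleftrightarrow> (\<gamma> - a) / (1 - a) * x - 1 < r"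
      using assms by (simp add: field_simps)
    then show ?thesis
      using r assms by (simp add: bad_interval_def alpha_def ennreal_less_iff)
  next
    case False
    then show ?thesis using assms by (simp add: bad_interval_def alpha_def)
  qed
qed

text \<open>\<open>r\<close> is the buying time whose ratio would be exactly
  \<open>\<gamma>\<close>. Past \<open>x\<close> the ratio is constant, so later times, never buying
  included, are all bad or all harmless. \<open>r < x\<close> means
  \<open>x > I3 a \<gamma>\<close>; since \<open>r\<close> is nondecreasing in \<open>x\<close> and
  equals \<open>I3\<close> at \<open>x = I3\<close>, no bad time precedes \<open>I3\<close>.\<close>

lemma bad_interval_gt_one:
  assumes a: "0 \<le> a" "a < 1" and \<gamma>: "2 - a \<le> \<gamma>" "a * \<gamma> < 1" and x: "1 < x"
  defines "r \<equiv> (\<gamma> - 1) * (1 - a + a * x) / (1 - a)"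
  shows "bad_interval a \<gamma> (ennreal x) =
    (if \<gamma> < x / (1 - a + a * x) then {ennreal r<..} else {t. t \<le> ennreal x \<and> r < enn2real t})"
    and "r < x \<Longrightarrow> I3 a \<gamma> \<le> r"
    and "\<gamma> < x / (1 - a + a * x) \<Longrightarrow> r < x"
proof -
  have D: "0 < 1 - a + a * x" using a x by (auto intro: add_pos_nonneg)
  have r: "r * (1 - a) = (\<gamma> - 1) * (1 - a + a * x)"
    using a by (simp add: r_def)
  have r0: "0 \<le> r" using a \<gamma> D by (simp add: r_def)
  have I3: "I3 a \<gamma> * (1 - a * \<gamma>) = (\<gamma> - 1) * (1 - a)"
    using \<gamma> by (simp add: I3_def)
  have rx: "r < x \<longleftrightarrow> (\<gamma> - 1) * (1 - a) < x * (1 - a * \<gamma>)"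
  proof -
    have "r < x \<longleftrightarrow> r * (1 - a) < x * (1 - a)" using a by simp
    moreover have "x * (1 - a) - r * (1 - a) = x * (1 - a * \<gamma>) - (\<gamma> - 1) * (1 - a)"
      unfolding r by (simp add: algebra_simps)
    ultimately show ?thesis by linarith
  qed
  show "I3 a \<gamma> \<le> r" if "r < x"
  proof -
    have "I3 a \<gamma> * (1 - a * \<gamma>) \<le> x * (1 - a * \<gamma>)" using that rx I3 by simp
    then have "I3 a \<gamma> \<le> x" using \<gamma> by simp
    then have "((\<gamma> - 1) * a) * I3 a \<gamma> \<le> ((\<gamma> - 1) * a) * x"
      using a \<gamma> by (intro mult_left_mono) auto
    then have "I3 a \<gamma> * (1 - a) \<le> r * (1 - a)"
      using I3 r by (simp add: algebra_simps)
    then show ?thesis using a by simp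
  qed
  show less: "r < x" if "\<gamma> < x / (1 - a + a * x)"
    using that D a rx by (simp add: pos_less_divide_eq algebra_simps)
  show "bad_interval a \<gamma> (ennreal x) =
    (if \<gamma> < x / (1 - a + a * x) then {ennreal r<..} else {t. t \<le> ennreal x \<and> r < enn2real t})"
  proof (intro set_eqI)
    fix t :: ennreal
    show "t \<in> bad_interval a \<gamma> (ennreal x) \<longleftrightarrow> t \<in>
      (if \<gamma> < x / (1 - a + a * x) then {ennreal r<..} else {t. t \<le> ennreal x \<and> r < enn2real t})"
    proof (cases "t \<le> ennreal x")
      case True
      then obtain s where s: "t = ennreal s" "0 \<le> s" "s \<le> x"
        using x by (cases t) (auto simp: top_unique)
      have "\<gamma> < (s + 1 - a + a * (x - s)) / (1 - a + a * x) \<longleftrightarrow> r * (1 - a) < s * (1 - a)"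
      proof -
        have "s * (1 - a) - r * (1 - a)
            = (s + 1 - a + a * (x - s)) - \<gamma> * (1 - a + a * x)"
          unfolding r by (simp add: algebra_simps)
        then show ?thesis using D by (auto simp: pos_less_divide_eq)
      qed
      also have "\<dots> \<longleftrightarrow> r < s" using a by simp
      finally show ?thesis
        using s a \<gamma> x r0 by (simp add: bad_interval_def alpha_def ennreal_less_iff)
    next
      case False
      then have "ennreal r < t" if "r < x"
        using that ennreal_leI[of r x] by (meson le_less_trans less_imp_le not_le)
      then show ?thesis
        using False a \<gamma> x less by (auto simp: bad_interval_def alpha_def ennreal_less_iff)
    qed
  qed
qed

text \<open>A nonempty bad interval for finite \<open>x\<close> either lies within the times before
  1 or starts at some \<open>r \<ge> I3 a \<gamma>\<close>, ending at \<open>x\<close> or reaching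
  infinity. The three comparisons cover these shapes and leave the times from 1 to \<open>I3\<close>
  free.\<close>

lemma feasible_transfer:
  assumes a: "0 \<le> a" "a < 1" and \<gamma>: "2 - a \<le> \<gamma>" "a * \<gamma> < 1"
    and f: "feasible a \<gamma> \<delta> f" and f': "purchase_distribution f'"
    and low: "\<And>x. 0 \<le> x \<Longrightarrow> x < 1 \<Longrightarrow> dist_cdf f' x \<le> dist_cdf f x"
    and diff: "\<And>x y. 0 \<le> x \<Longrightarrow> x \<le> y \<Longrightarrow> y < 1 \<or> I3 a \<gamma> \<le> x \<Longrightarrow>
      dist_cdf f' y - dist_cdf f' x \<le> dist_cdf f y - dist_cdf f x"
    and high: "\<And>x. 0 \<le> x \<Longrightarrow> I3 a \<gamma> \<le> x \<Longrightarrow> dist_cdf f x \<le> dist_cdf f' x"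
  shows "feasible a \<gamma> \<delta> f'"
proof -
  have pf: "purchase_distribution f"
    and tail: "\<And>x. 0 < x \<Longrightarrow> measure f (bad_interval a \<gamma> x) \<le> \<delta>"
    using f by (auto simp: feasible_def)
  interpret f: prob_space f using pf by (simp add: purchase_distribution_def)
  interpret f': prob_space f' using f' by (simp add: purchase_distribution_def)
  have sets: "sets f = sets borel" "sets f' = sets borel"
    using pf f' by (auto simp: purchase_distribution_def)
  have real: "measure f' (bad_interval a \<gamma> (ennreal x)) \<le> \<delta>" if x: "0 < x" for x
  proof -
    have "measure f' (bad_interval a \<gamma> (ennreal x)) \<le> measure f (bad_interval a \<gamma> (ennreal x))"
    proof (cases "x \<le> 1")
      case True
      define l where "l = (\<gamma> - a) / (1 - a) * x - 1"
      \<comment> \<open>Since \<open>\<gamma> \<ge> 2 - a\<close> gives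
        \<open>l \<ge> 2 * x - 1\<close>, a nonempty bad interval here forces
        \<open>x < 1\<close>.\<close>
      have "x < 1" if "l < x"
      proof -
        have "2 \<le> (\<gamma> - a) / (1 - a)" using a \<gamma> by (simp add: field_simps)
        then have "2 * x \<le> (\<gamma> - a) / (1 - a) * x" using x by (intro mult_right_mono) auto
        then show ?thesis using that by (simp add: l_def)
      qed
      then show ?thesis
        unfolding bad_interval_le_one[OF a \<gamma>(1) x True] l_def[symmetric]
        using x low[of x] diff[of l x]
        by (auto simp: measure_above_below[OF pf] measure_above_below[OF f'])
    next
      case False
      then have x1: "1 < x" by simp
      define r where "r = (\<gamma> - 1) * (1 - a + a * x) / (1 - a)"
      have r0: "0 \<le> r" using a \<gamma> x by (simp add: r_def)
      note bad = bad_interval_gt_one[OF a \<gamma> x1, folded r_def]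
      have "measure M {ennreal r<..} = 1 - dist_cdf M r" if "purchase_distribution M" for M
      proof -
        interpret M: prob_space M using that by (simp add: purchase_distribution_def)
        have s: "sets M = sets borel" using that by (simp add: purchase_distribution_def)
        have "{ennreal r<..} = space M - {..ennreal r}"
          using sets_eq_imp_space_eq[OF s] by auto
        then show ?thesis by (simp add: M.prob_compl s dist_cdf_def)
      qed
      then show ?thesis
        unfolding bad(1)
        using x r0 bad(2,3) high[of r] diff[of r x] pf f'
        by (auto simp: measure_above_below[OF pf] measure_above_below[OF f'])
    qed
    then show ?thesis using tail[of "ennreal x"] x by simp
  qed
  have "measure f' (bad_interval a \<gamma> \<infinity>) \<le> \<delta>"
  proof -
    \<comment> \<open>At most \<open>\<infinity>\<close> itself is bad for the infinite stopping
      time. This finite \<open>x\<close> is large enough that never buying is bad for it too, which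
      reduces the claim to the finite case.\<close>
    define x where "x = (\<gamma> * (1 - a) + 1) / (1 - a * \<gamma>)"
    have xa: "x * (1 - a * \<gamma>) = \<gamma> * (1 - a) + 1" using \<gamma> by (simp add: x_def)
    have "1 * (1 - a * \<gamma>) < x * (1 - a * \<gamma>)"
      unfolding xa using a \<gamma> by (simp add: algebra_simps)
    then have x1: "1 < x" using \<gamma> by (simp only: mult_less_cancel_right_pos)
    have "0 < 1 - a + a * x" using a x1 by (auto intro: add_pos_nonneg)
    then have "\<gamma> < x / (1 - a + a * x)"
      using xa by (simp add: pos_less_divide_eq algebra_simps)
    then have "\<infinity> \<in> bad_interval a \<gamma> (ennreal x)"
      using bad_interval_gt_one(1)[OF a \<gamma> x1] by simp
    moreover have "bad_interval a \<gamma> \<infinity> \<subseteq> {\<infinity>}"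
      using \<gamma> a ennreal_leI[of 1 \<gamma>]
      by (auto simp: bad_interval_def alpha_def not_less top_unique split: if_splits)
    ultimately have "measure f' (bad_interval a \<gamma> \<infinity>) \<le> measure f' (bad_interval a \<gamma> (ennreal x))"
      by (intro f'.finite_measure_mono) (auto simp: sets)
    then show ?thesis using real[of x] x1 by simp
  qed
  then have "measure f' (bad_interval a \<gamma> x) \<le> \<delta>" if "0 < x" for x
    using real that by (cases x) auto
  then show ?thesis using f' by (simp add: feasible_def)
qed

section \<open>Finiteness of the optimum and the ratio at infinity\<close>

lemma OPT_le:
  assumes a: "0 \<le> a" "a < 1" and \<gamma>: "2 - a \<le> \<gamma>" and \<delta>: "0 \<le> \<delta>"
  shows "OPT a \<gamma> \<delta> \<le> ennreal (2 - a)"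
proof -
  \<comment> \<open>Buying at time 1 for sure has ratio at most \<open>2 - a \<le> \<gamma>\<close>
    everywhere, so no tail mass arises.\<close>
  let ?f = "return borel (1 :: ennreal)"
  have alpha: "alpha a 1 x \<le> ennreal (2 - a)" if "0 < x" for x
  proof (cases x)
    case (real r)
    show ?thesis
    proof (cases "r \<le> 1")
      case True
      then show ?thesis using real that a
        by (cases "r = 1") (auto simp: alpha_def ennreal_le_1 simp flip: ennreal_1)
    next
      case False
      have "0 < 1 - a + a * r" using a False by (auto intro: add_pos_nonneg)
      \<comment> \<open>This product is exactly \<open>(2 - a) * (1 - a + a * r)\<close> minus the
        numerator.\<close>
      moreover have "0 \<le> a * (1 - a) * (r - 1)" using a False by simp
      ultimately have "(1 + 1 - a + a * (r - 1)) / (1 - a + a * r) \<le> 2 - a"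
        by (subst pos_divide_le_eq) (auto simp: algebra_simps)
      then show ?thesis using False real a
        by (auto simp: alpha_def simp flip: ennreal_1 intro!: ennreal_leI)
    qed
  next
    case top
    then show ?thesis using a by (auto simp: alpha_def simp flip: ennreal_1 intro!: ennreal_leI)
  qed
  have "measure ?f (bad_interval a \<gamma> x) = 0" if "0 < x" for x
    using order_trans[OF alpha[OF that] ennreal_leI[OF \<gamma>]]
    by (simp add: measure_return bad_interval_def[of a \<gamma> x] indicator_def not_less)
  then have "feasible a \<gamma> \<delta> ?f"
    using \<delta> by (auto simp: feasible_def purchase_distribution_def prob_space_return)
  then have "OPT a \<gamma> \<delta> \<le> worst_case a ?f"
    unfolding OPT_def by (intro INF_lower) simp
  also have "\<dots> \<le> ennreal (2 - a)"
    unfolding worst_case_def alpha_dist_def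
    by (intro SUP_least) (auto simp: nn_integral_return alpha)
  finally show ?thesis .
qed

text \<open>If \<open>p\<close> is the mass of never buying, the ratio is
  \<open>1 - p + p / a\<close>, and the hypothesis on the distribution function gives
  \<open>p \<le> a * c\<close>.\<close>

lemma alpha_dist_infinity_le:
  assumes a: "0 \<le> a" "a < 1" and c: "0 \<le> c" and f: "purchase_distribution f"
    and cdf: "1 - a * c \<le> dist_cdf f x"
  shows "alpha_dist a f \<infinity> \<le> ennreal (1 + (1 - a) * c)"
proof -
  interpret prob_space f using f by (simp add: purchase_distribution_def)
  have sets [measurable_cong, simp]: "sets f = sets borel"
    using f by (simp add: purchase_distribution_def)
  have space: "space f = UNIV" using sets_eq_imp_space_eq[OF sets] by simp
  define p where "p = prob {\<infinity>}"
  have p: "prob {..<\<infinity>} = 1 - p"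
  proof -
    have "{..<\<infinity>} = space f - {\<infinity>}" by (auto simp: space not_less top_unique)
    then show ?thesis using prob_compl[of "{\<infinity>}"] by (simp add: p_def)
  qed
  have p01: "0 \<le> p" "p \<le> 1" by (auto simp: p_def)
  have "dist_cdf f x \<le> prob {..<\<infinity>}"
    unfolding dist_cdf_def by (intro finite_measure_mono) (auto intro: le_less_trans)
  then have pa: "p \<le> a * c" using p cdf by simp
  have "alpha_dist a f \<infinity>
      = (\<integral>\<^sup>+ t. indicator {..<\<infinity>} t + 1 / ennreal a * indicator {\<infinity>} t \<partial>f)"
    unfolding alpha_dist_def
    by (intro nn_integral_cong) (auto simp: alpha_def indicator_def top.not_eq_extremum)
  also have "\<dots> = ennreal (1 - p) + 1 / ennreal a * ennreal p"
  proof -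
    have "emeasure f {..<\<infinity>} = ennreal (1 - p)" "emeasure f {\<infinity>} = ennreal p"
      by (simp_all only: emeasure_eq_measure p p_def)
    then show ?thesis by (subst nn_integral_add) (auto simp: nn_integral_cmult)
  qed
  also have "\<dots> \<le> ennreal (1 + (1 - a) * c)"
  proof (cases "a = 0")
    case True
    \<comment> \<open>Here the ratio of never buying is infinite, but its weight is 0 and the
      product is 0 in \<open>ennreal\<close>.\<close>
    then have "p = 0" using pa p01 by simp
    then show ?thesis using True c by (auto intro: ennreal_leI simp flip: ennreal_1)
  next
    case False
    then have "1 / ennreal a * ennreal p = ennreal (p / a)"
      using a p01 by (simp add: divide_ennreal flip: ennreal_1 ennreal_mult)
    moreover have "p * (1 - a) \<le> (a * c) * (1 - a)"
      using pa a by (intro mult_right_mono) auto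
    then have "(1 - p) + p / a \<le> 1 + (1 - a) * c"
      using False a by (simp add: field_simps)
    ultimately show ?thesis
      using p01 a by (simp add: ennreal_leI flip: ennreal_plus)
  qed
  finally show ?thesis .
qed

section \<open>Contradiction with optimality\<close>

theorem theorem11:
  fixes a \<gamma> \<delta> :: real and f :: "ennreal measure"
  assumes "0 \<le> a" and "a < 1"
    and "2 - a \<le> \<gamma>" and "a = 0 \<or> \<gamma> < 1 / a"
    and "0 \<le> \<delta>" and "\<delta> \<le> 1"
    and "optimal a \<gamma> \<delta> f"
  shows "\<forall>x\<in>{1..I3 a \<gamma>}. alpha_dist a f (ennreal x) = OPT a \<gamma> \<delta>"
proof (intro ballI, rule ccontr)
  fix x0 assume x0: "x0 \<in> {1..I3 a \<gamma>}" and neq: "alpha_dist a f (ennreal x0) \<noteq> OPT a \<gamma> \<delta>"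
  note a = assms(1,2)
  have \<gamma>: "2 - a \<le> \<gamma>" "a * \<gamma> < 1"
    using assms(1,3,4) by (cases "a = 0"; simp add: pos_less_divide_eq mult.commute)+
  have feas: "feasible a \<gamma> \<delta> f" and worst: "worst_case a f = OPT a \<gamma> \<delta>"
    using assms(7) by (auto simp: optimal_def)
  have pf: "purchase_distribution f" using feas by (simp add: feasible_def)
  interpret prob_space f using pf by (simp add: purchase_distribution_def)
  have le_OPT: "alpha_dist a f x \<le> OPT a \<gamma> \<delta>" if "0 < x" for x
    using that unfolding worst[symmetric] worst_case_def by (intro SUP_upper) auto
  obtain C where C: "OPT a \<gamma> \<delta> = ennreal C" "0 \<le> C"
    using OPT_le[OF a \<gamma>(1) assms(5)] by (cases "OPT a \<gamma> \<delta>") (auto simp: top_unique)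
  \<comment> \<open>At stopping time 1 every buying time has ratio at least 1; this yields
    \<open>0 \<le> c\<close>.\<close>
  have "1 \<le> C"
  proof -
    have "1 \<le> alpha a t 1" for t
    proof (cases "t \<le> 1")
      case True
      then obtain r where r: "t = ennreal r" "0 \<le> r" "r \<le> 1"
        by (cases t) (auto simp: top_unique)
      moreover have "a * r \<le> r" using a r by (simp add: mult_left_le_one_le)
      ultimately show ?thesis using True by (simp add: alpha_def algebra_simps)
    qed (simp add: alpha_def)
    then have "(\<integral>\<^sup>+ t. 1 \<partial>f) \<le> alpha_dist a f 1"
      unfolding alpha_dist_def by (intro nn_integral_mono) auto
    also have "alpha_dist a f 1 \<le> ennreal C"
      using le_OPT[of 1] C by simp
    finally show ?thesis by (simp add: emeasure_space_1)
  qed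
  define c where "c = (C - 1) / (1 - a)"
  have c: "0 \<le> c" and C_eq: "C = 1 + (1 - a) * c"
    using a \<open>1 \<le> C\<close> by (auto simp: c_def)
  define F where "F = dist_cdf f"
  have bound: "F x - primitive F x \<le> (if x \<le> 1 then c * x else c - (1 - a * c) * (x - 1))"
    if x: "0 < x" for x
    using le_OPT[of "ennreal x"] x C
      ratio_bound_iff(1)[OF a x, where G="F x - primitive F x" and c=c]
    by (auto simp: alpha_dist_real[OF pf a x] C_eq F_def)
  have x0_pos: "0 < x0" using x0 by simp
  have "alpha_dist a f (ennreal x0) < ennreal C"
    using le_OPT[of "ennreal x0"] x0 neq C by (simp add: order_less_le)
  then have "(x0 + (1 - a) * (F x0 - primitive F x0)) / (if x0 \<le> 1 then x0 else 1 - a + a * x0)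
      < 1 + (1 - a) * c"
    using ennreal_leI unfolding alpha_dist_real[OF pf a x0_pos] C_eq F_def
    by (meson not_le)
  \<comment> \<open>The point 1 falls under the first branch of the bound, where both expressions
    equal \<open>c\<close>.\<close>
  then have strict: "F x0 - primitive F x0 < c - (1 - a * c) * (x0 - 1)"
    using ratio_bound_iff(2)[OF a x0_pos, where G="F x0 - primitive F x0" and c=c] x0
    by (cases "x0 = 1") auto
  obtain c' F' where c': "0 \<le> c'" "c' < c" and F': "cdf_like F'"
    and low: "\<And>x. x < 1 \<Longrightarrow> F' x \<le> F x"
    and diff: "\<And>x y. x \<le> y \<Longrightarrow> y < 1 \<or> I3 a \<gamma> \<le> x \<Longrightarrow> F' y - F' x \<le> F y - F x"
    and high: "\<And>x. I3 a \<gamma> \<le> x \<Longrightarrow> F x \<le> F' x"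
    and F'_I3: "1 - a * c' \<le> F' (I3 a \<gamma>)"
    and early': "\<And>x. 0 < x \<Longrightarrow> x \<le> 1 \<Longrightarrow> F' x - primitive F' x \<le> c' * x"
    and late': "\<And>x. 1 \<le> x \<Longrightarrow> F' x - primitive F' x \<le> c' - (1 - a * c') * (x - 1)"
  proof (rule improve_cdf[of F a c x0 "I3 a \<gamma>"])
    show "cdf_like F" unfolding F_def by (rule cdf_like_dist_cdf[OF pf])
    show "F x - primitive F x \<le> c * x" if "0 < x" "x \<le> 1" for x
      using bound[of x] that by simp
    show "F x - primitive F x \<le> c - (1 - a * c) * (x - 1)" if "1 \<le> x" for x
      using bound[of x] that by (cases "x = 1") auto
  qed (use a c x0 strict in auto)
  obtain g where g: "purchase_distribution g" and cdf_g: "\<And>x. 0 \<le> x \<Longrightarrow> dist_cdf g x = F' x"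
    using exists_distribution_with_cdf[OF F'] by blast
  have prim_g: "primitive (dist_cdf g) x = primitive F' x" for x
    by (intro integral_cong) (simp add: cdf_g)
  have "feasible a \<gamma> \<delta> g"
    using low diff high
    by (intro feasible_transfer[OF a \<gamma> feas g]) (auto simp: cdf_g F_def)
  then have "OPT a \<gamma> \<delta> \<le> worst_case a g"
    unfolding OPT_def by (intro INF_lower) simp
  also have "\<dots> \<le> ennreal (1 + (1 - a) * c')"
    unfolding worst_case_def
  proof (intro SUP_least)
    fix x :: ennreal assume "x \<in> {0<..}"
    then show "alpha_dist a g x \<le> ennreal (1 + (1 - a) * c')"
    proof (cases x)
      case (real r)
      then have r: "0 < r" using \<open>x \<in> {0<..}\<close> by (cases "r = 0") auto
      show ?thesis
        using ratio_bound_iff(1)[OF a r, where G="F' r - primitive F' r" and c=c']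
          early'[of r] late'[of r] r
        by (auto simp: real alpha_dist_real[OF g a r] cdf_g prim_g intro!: ennreal_leI)
    next
      case top
      then show ?thesis
        using alpha_dist_infinity_le[OF a c'(1) g, of "I3 a \<gamma>"] F'_I3 x0 by (simp add: cdf_g)
    qed
  qed
  \<comment> \<open>The strict drop from \<open>c\<close> to \<open>c'\<close> contradicts
    minimality.\<close>
  also have "\<dots> < OPT a \<gamma> \<delta>"
    unfolding C(1) C_eq using a c' by (intro ennreal_lessI) (auto intro: add_pos_nonneg)
  finally show False by simp
qed

end
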